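(* The construction $X(G)$ is part of a covariant functor from the category $\mathfrak{C}$ of finite groups and homomorphisms injective on commutators to the category $\mathfrak{D}$ of finite oriented $2$-dimensional simplicial complexes and orientation preserving simplicial maps. In particular, if $G_1$ is isomorphic to $G_2$ then $X(G_1)$ is simplicially isomorphic to $X(G_2)$, and if $H\le G$ then $X(H)$ is a subcomplex of $X(G)$.
   Context: For a finite group $G$ with center $Z(G)$, $X(G)$ is the simplicial complex with vertex set $\{(x,1): x\in G-Z(G)\}\sqcup\{(x,2): x\in G-Z(G)\}$, whose edges are $[(x,1),(y,1)]$ and $[(x,1),(y,2)]$ for all $x,y$ with $xy\ne yx$, and whose $2$-faces are $[(x,1),(y,1),(xy,2)]$ for all ordered pairs $(x,y)$ with $xy\neq yx$, each oriented by the vertex order indicated. It is $2$-dimensional if $G$ is nonabelian and is the empty complex if $G$ is abelian (the empty complex is admitted as an object of $\mathfrak D$). A group homomorphism $f:G\to H$ is injective on commutators if its restriction to the commutator subgroup $G'$ of $G$ is injective. An oriented $2$-dimensional simplicial complex is one in which every $2$-simplex has been given an orientation; a simplicial map is orientation preserving if it takes $2$-simplices to $2$-simplices and preserves the orientation of the individual $2$-simplices. On morphisms the functor is given on vertices by $X(f)((v,i))=(f(v),i)$ for $i=1,2$. *)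

theory Defs
  imports "HOL-Algebra.Generated_Groups" "HOL-Combinatorics.Permutations"
begin

section \<open>Categories and functors\<close>

text \<open>Hom-sets are indexed by source and target and need not be disjoint, so composition
  receives the three objects involved: \<open>Comp C A B D g f\<close> is the composite of \<open>f\<close> from \<open>A\<close> to \<open>B\<close>
  with \<open>g\<close> from \<open>B\<close> to \<open>D\<close>.\<close>

record ('o, 'm) category =
  Obj :: "'o set"
  Hom :: "'o \<Rightarrow> 'o \<Rightarrow> 'm set"
  Ident :: "'o \<Rightarrow> 'm"
  Comp :: "'o \<Rightarrow> 'o \<Rightarrow> 'o \<Rightarrow> 'm \<Rightarrow> 'm \<Rightarrow> 'm"

locale category =
  fixes C :: "('o, 'm) category"
  assumes Ident_in_Hom: "A \<in> Obj C \<Longrightarrow> Ident C A \<in> Hom C A A"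
    and Comp_in_Hom: "\<lbrakk>A \<in> Obj C; B \<in> Obj C; D \<in> Obj C; f \<in> Hom C A B; g \<in> Hom C B D\<rbrakk>
          \<Longrightarrow> Comp C A B D g f \<in> Hom C A D"
    and Comp_Ident_right: "\<lbrakk>A \<in> Obj C; B \<in> Obj C; f \<in> Hom C A B\<rbrakk>
          \<Longrightarrow> Comp C A A B f (Ident C A) = f"
    and Comp_Ident_left: "\<lbrakk>A \<in> Obj C; B \<in> Obj C; f \<in> Hom C A B\<rbrakk>
          \<Longrightarrow> Comp C A B B (Ident C B) f = f"
    and Comp_assoc: "\<lbrakk>A \<in> Obj C; B \<in> Obj C; D \<in> Obj C; E \<in> Obj C;
            f \<in> Hom C A B; g \<in> Hom C B D; h \<in> Hom C D E\<rbrakk>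
          \<Longrightarrow> Comp C A D E h (Comp C A B D g f) = Comp C A B E (Comp C B D E h g) f"

locale covariant_functor =
  source: category C + target: category D
  for C :: "('o1, 'm1) category" and D :: "('o2, 'm2) category" +
  fixes F_obj :: "'o1 \<Rightarrow> 'o2" and F_mor :: "'o1 \<Rightarrow> 'o1 \<Rightarrow> 'm1 \<Rightarrow> 'm2"
  assumes F_obj_in_Obj: "A \<in> Obj C \<Longrightarrow> F_obj A \<in> Obj D"
    and F_mor_in_Hom: "\<lbrakk>A \<in> Obj C; B \<in> Obj C; f \<in> Hom C A B\<rbrakk>
          \<Longrightarrow> F_mor A B f \<in> Hom D (F_obj A) (F_obj B)"
    and F_mor_Ident: "A \<in> Obj C \<Longrightarrow> F_mor A A (Ident C A) = Ident D (F_obj A)"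
    and F_mor_Comp: "\<lbrakk>A \<in> Obj C; B \<in> Obj C; E \<in> Obj C; f \<in> Hom C A B; g \<in> Hom C B E\<rbrakk>
          \<Longrightarrow> F_mor A E (Comp C A B E g f)
              = Comp D (F_obj A) (F_obj B) (F_obj E) (F_mor B E g) (F_mor A B f)"


section \<open>Finite groups and homomorphisms injective on commutators\<close>

text \<open>Morphisms out of \<open>G\<close> are functions that are \<open>undefined\<close> outside \<open>carrier G\<close>, so that equality
  of morphisms is equality on the carrier.\<close>

definition hom_inj_comm :: "'a monoid \<Rightarrow> 'b monoid \<Rightarrow> ('a \<Rightarrow> 'b) set" where
  "hom_inj_comm G H =
     {f \<in> hom G H \<inter> extensional (carrier G). inj_on f (derived G (carrier G))}"

definition group_cat :: "('a monoid, 'a \<Rightarrow> 'a) category" where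
  "group_cat = \<lparr>
     Obj = {G. group G \<and> finite (carrier G)},
     Hom = hom_inj_comm,
     Ident = (\<lambda>G. \<lambda>x\<in>carrier G. x),
     Comp = (\<lambda>G H K g f. compose (carrier G) g f)\<rparr>"


section \<open>Finite oriented 2-dimensional simplicial complexes\<close>

text \<open>An ordering of a simplex is a repetition-free list of its vertices, and an orientation is
  a class of orderings modulo even permutations.\<close>

definition orderings :: "'v set \<Rightarrow> 'v list set" where
  "orderings s = {vs. distinct vs \<and> set vs = s}"

definition even_perm_rel :: "('v list \<times> 'v list) set" where
  "even_perm_rel =
     {(vs, ws). \<exists>p. p permutes {..<length vs} \<and> evenperm p \<and> ws = permute_list p vs}"

definition orientations :: "'v set \<Rightarrow> 'v list set set" where
  "orientations s = orderings s // even_perm_rel"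

record 'v oriented_complex =
  verts :: "'v set"
  simplices :: "'v set set"
  orient :: "'v set \<Rightarrow> 'v list set"

definition abstract_simplicial_complex :: "'v oriented_complex \<Rightarrow> bool" where
  "abstract_simplicial_complex K \<longleftrightarrow>
     (\<forall>s\<in>simplices K. s \<noteq> {} \<and> finite s \<and> s \<subseteq> verts K) \<and>
     (\<forall>v\<in>verts K. {v} \<in> simplices K) \<and>
     (\<forall>s\<in>simplices K. \<forall>t. t \<subseteq> s \<and> t \<noteq> {} \<longrightarrow> t \<in> simplices K)"

definition two_simplices :: "'v oriented_complex \<Rightarrow> 'v set set" where
  "two_simplices K = {s \<in> simplices K. card s = 3}"

text \<open>Off the 2-simplices \<open>orient\<close> carries no information and is fixed to be empty. The empty
  complex is admitted besides the complexes of dimension exactly 2.\<close>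

definition finite_oriented_2_complex :: "'v oriented_complex \<Rightarrow> bool" where
  "finite_oriented_2_complex K \<longleftrightarrow>
     abstract_simplicial_complex K \<and> finite (verts K) \<and>
     (\<forall>s\<in>simplices K. card s \<le> 3) \<and>
     (verts K = {} \<or> two_simplices K \<noteq> {}) \<and>
     (\<forall>s\<in>two_simplices K. orient K s \<in> orientations s) \<and>
     (\<forall>s. s \<notin> two_simplices K \<longrightarrow> orient K s = {})"

definition simplicial_map ::
    "('v \<Rightarrow> 'w) \<Rightarrow> 'v oriented_complex \<Rightarrow> 'w oriented_complex \<Rightarrow> bool" where
  "simplicial_map \<phi> K L \<longleftrightarrow>
     \<phi> \<in> verts K \<rightarrow> verts L \<and> (\<forall>s\<in>simplices K. \<phi> ` s \<in> simplices L)"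

definition orientation_preserving ::
    "('v \<Rightarrow> 'w) \<Rightarrow> 'v oriented_complex \<Rightarrow> 'w oriented_complex \<Rightarrow> bool" where
  "orientation_preserving \<phi> K L \<longleftrightarrow>
     (\<forall>s\<in>two_simplices K.
        \<phi> ` s \<in> two_simplices L \<and> map \<phi> ` orient K s = orient L (\<phi> ` s))"

definition oriented_simplicial_maps ::
    "'v oriented_complex \<Rightarrow> 'w oriented_complex \<Rightarrow> ('v \<Rightarrow> 'w) set" where
  "oriented_simplicial_maps K L =
     {\<phi> \<in> extensional (verts K). simplicial_map \<phi> K L \<and> orientation_preserving \<phi> K L}"

definition complex_cat :: "('v oriented_complex, 'v \<Rightarrow> 'v) category" where
  "complex_cat = \<lparr>
     Obj = {K. finite_oriented_2_complex K},
     Hom = oriented_simplicial_maps,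
     Ident = (\<lambda>K. \<lambda>v\<in>verts K. v),
     Comp = (\<lambda>K L M \<psi> \<phi>. compose (verts K) \<psi> \<phi>)\<rparr>"

definition simplicial_iso ::
    "('v \<Rightarrow> 'w) \<Rightarrow> 'v oriented_complex \<Rightarrow> 'w oriented_complex \<Rightarrow> bool" where
  "simplicial_iso \<phi> K L \<longleftrightarrow>
     bij_betw \<phi> (verts K) (verts L) \<and>
     simplicial_map \<phi> K L \<and> simplicial_map (inv_into (verts K) \<phi>) L K"

text \<open>A subcomplex carries the induced orientation.\<close>

definition subcomplex :: "'v oriented_complex \<Rightarrow> 'v oriented_complex \<Rightarrow> bool" where
  "subcomplex K L \<longleftrightarrow>
     abstract_simplicial_complex K \<and>
     verts K \<subseteq> verts L \<and> simplices K \<subseteq> simplices L \<and>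
     (\<forall>s\<in>two_simplices K. orient K s = orient L s)"


section \<open>The construction X(G)\<close>

definition group_center :: "('a, 'b) monoid_scheme \<Rightarrow> 'a set" where
  "group_center G = {z \<in> carrier G. \<forall>g\<in>carrier G. z \<otimes>\<^bsub>G\<^esub> g = g \<otimes>\<^bsub>G\<^esub> z}"

definition noncommuting :: "('a, 'b) monoid_scheme \<Rightarrow> ('a \<times> 'a) set" where
  "noncommuting G =
     {(x, y). x \<in> carrier G \<and> y \<in> carrier G \<and> x \<otimes>\<^bsub>G\<^esub> y \<noteq> y \<otimes>\<^bsub>G\<^esub> x}"

definition X_face :: "('a, 'b) monoid_scheme \<Rightarrow> 'a \<Rightarrow> 'a \<Rightarrow> ('a \<times> nat) list" where
  "X_face G x y = [(x, 1), (y, 1), (x \<otimes>\<^bsub>G\<^esub> y, 2)]"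

text \<open>The union defining \<open>orient\<close> has at most one distinct nonempty term: a 2-simplex determines
  the pair \<open>x, y\<close> up to order, and the faces of \<open>(x, y)\<close> and \<open>(y, x)\<close> differ when
  \<open>x\<close> and \<open>y\<close> do not commute.\<close>

definition X :: "('a, 'b) monoid_scheme \<Rightarrow> ('a \<times> nat) oriented_complex" where
  "X G = \<lparr>
     verts = (carrier G - group_center G) \<times> {1, 2},
     simplices =
       {{v} | v. v \<in> (carrier G - group_center G) \<times> {1, 2}} \<union>
       {{(x, 1), (y, 1)} | x y. (x, y) \<in> noncommuting G} \<union>
       {{(x, 1), (y, 2)} | x y. (x, y) \<in> noncommuting G} \<union>
       {set (X_face G x y) | x y. (x, y) \<in> noncommuting G},
     orient = (\<lambda>s. \<Union>{even_perm_rel `` {X_face G x y} | x y.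
                       (x, y) \<in> noncommuting G \<and> set (X_face G x y) = s})\<rparr>"

definition X_map :: "('a, 'c) monoid_scheme \<Rightarrow> ('a \<Rightarrow> 'b) \<Rightarrow> 'a \<times> nat \<Rightarrow> 'b \<times> nat" where
  "X_map G f = (\<lambda>(v, i)\<in>verts (X G). (f v, i))"

end

theory Submission
  imports Defs
begin

text \<open>If \<open>x\<close> and \<open>y\<close> do not commute, then \<open>[x, y] \<noteq> 1\<close> lies in \<open>G'\<close>, so a homomorphism that is
  injective on \<open>G'\<close> keeps \<open>f x\<close> and \<open>f y\<close> from commuting and carries the ordered face of
  \<open>(x, y)\<close> to that of \<open>(f x, f y)\<close>. A 2-simplex of \<open>X(G)\<close> comes from one ordered pair only,
  since its vertex of level 2 tells \<open>xy\<close> from \<open>yx\<close>; this makes the orientation well defined.\<close>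

section \<open>Orientation classes, commutators and non-commuting pairs\<close>

lemma even_perm_rel_map:
  "map f ` (even_perm_rel `` {vs}) = even_perm_rel `` {map f vs}"
  \<comment> \<open>A permutation moves positions while \<open>map f\<close> changes entries, so the
    two operations commute.\<close>
  by (auto simp: even_perm_rel_def permute_list_map image_iff)

text \<open>The commutator has the shape of the generators of \<open>derived\<close>, so that it can
  later be fed to \<open>generate.incl\<close>.\<close>

lemma (in group) commutator_eq_one_iff:
  assumes "x \<in> carrier G" "y \<in> carrier G"
  shows "x \<otimes> y \<otimes> inv x \<otimes> inv y = \<one> \<longleftrightarrow> x \<otimes> y = y \<otimes> x"
  using assms by (metis inv_closed inv_solve_right m_closed one_closed l_one)

lemma noncommuting_iff:
  "(x, y) \<in> noncommuting G \<longleftrightarrow>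
     x \<in> carrier G \<and> y \<in> carrier G \<and> x \<otimes>\<^bsub>G\<^esub> y \<noteq> y \<otimes>\<^bsub>G\<^esub> x"
  by (simp add: noncommuting_def)

text \<open>From here on a vertex is handled through a partner with which it does not
  commute.\<close>

lemma noncentral_iff:
  "x \<in> carrier G - group_center G \<longleftrightarrow> (\<exists>y. (x, y) \<in> noncommuting G)"
  by (auto simp: group_center_def noncommuting_iff)

lemma noncommuting_sym: "(x, y) \<in> noncommuting G \<Longrightarrow> (y, x) \<in> noncommuting G"
  by (auto simp: noncommuting_iff)

text \<open>If \<open>x\<close> commuted with \<open>x \<otimes> y\<close>, cancelling
  \<open>x\<close> on the left would make \<open>x\<close> and \<open>y\<close> commute; for
  \<open>y\<close>, cancel \<open>y\<close> on the right. This supplies the two edges of a face that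
  end in the product vertex, and shows that the product is noncentral.\<close>

lemma (in group) noncommuting_mult:
  assumes "(x, y) \<in> noncommuting G"
  shows "(x, x \<otimes> y) \<in> noncommuting G" "(y, x \<otimes> y) \<in> noncommuting G"
  using assms by (auto simp: noncommuting_iff m_assoc) (metis m_assoc right_cancel m_closed)+

section \<open>Vertices, 2-simplices and orientations of \<open>X G\<close>\<close>

lemma verts_X_iff:
  "(x, i) \<in> verts (X G) \<longleftrightarrow> i \<in> {1, 2} \<and> (\<exists>y. (x, y) \<in> noncommuting G)"
  by (auto simp: X_def simp flip: noncentral_iff)

lemma simplices_X_iff:
  "s \<in> simplices (X G) \<longleftrightarrow>
     (\<exists>v\<in>verts (X G). s = {v}) \<or>
     (\<exists>x y. (x, y) \<in> noncommuting G \<and>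
        (s = {(x, 1), (y, 1)} \<or> s = {(x, 1), (y, 2)} \<or> s = set (X_face G x y)))"
  unfolding X_def by auto

lemma distinct_X_face: "(x, y) \<in> noncommuting G \<Longrightarrow> distinct (X_face G x y)"
  by (auto simp: X_face_def noncommuting_iff)

text \<open>Vertices and edges have at most two elements, while the three vertices of a face are
  distinct.\<close>

lemma two_simplices_X_iff:
  "s \<in> two_simplices (X G) \<longleftrightarrow> (\<exists>x y. (x, y) \<in> noncommuting G \<and> s = set (X_face G x y))"
proof
  assume "s \<in> two_simplices (X G)"
  then show "\<exists>x y. (x, y) \<in> noncommuting G \<and> s = set (X_face G x y)"
    by (auto simp: two_simplices_def simplices_X_iff card_insert_if split: if_splits)
next
  assume "\<exists>x y. (x, y) \<in> noncommuting G \<and> s = set (X_face G x y)"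
  then obtain x y where xy: "(x, y) \<in> noncommuting G" "s = set (X_face G x y)" by blast
  then have "card s = 3"
    using distinct_card[OF distinct_X_face[OF xy(1)]] by (simp add: X_face_def)
  with xy show "s \<in> two_simplices (X G)"
    by (auto simp: two_simplices_def simplices_X_iff)
qed

lemma X_face_determines_pair:
  assumes "(x, y) \<in> noncommuting G" "(x', y') \<in> noncommuting G"
    and "set (X_face G x y) = set (X_face G x' y')"
  shows "x = x' \<and> y = y'"
proof -
  \<comment> \<open>Sorting the vertices by level recovers the unordered pair and its
    product.\<close>
  have fst_level: "{a. (a, 1) \<in> set (X_face G x y)} = {x, y}"
    and snd_level: "{a. (a, 2) \<in> set (X_face G x y)} = {x \<otimes>\<^bsub>G\<^esub> y}" for x y
    by (auto simp: X_face_def)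
  have "{x, y} = {x', y'}" "{x \<otimes>\<^bsub>G\<^esub> y} = {x' \<otimes>\<^bsub>G\<^esub> y'}"
    using assms(3) by (simp_all flip: fst_level snd_level)
  then show ?thesis
    \<comment> \<open>The swapped case would give
      \<open>x \<otimes> y = y \<otimes> x\<close>.\<close>
    using assms(1,2) by (auto simp: noncommuting_iff doubleton_eq_iff)
qed

lemma orient_X_face:
  assumes "(x, y) \<in> noncommuting G"
  shows "orient (X G) (set (X_face G x y)) = even_perm_rel `` {X_face G x y}"
  using assms by (auto simp: X_def dest: X_face_determines_pair)

section \<open>\<open>X G\<close> as a finite oriented 2-complex\<close>

lemma nonempty_subset_of_three:
  assumes "t \<subseteq> {a, b, c}" "t \<noteq> {}"
  shows "t \<in> {{a}, {b}, {c}, {a, b}, {a, c}, {b, c}, {a, b, c}}"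
proof -
  have "t \<in> Pow {a, b, c}" using assms(1) by simp
  with assms(2) show ?thesis by (simp add: Pow_insert) argo
qed

lemma (in group) abstract_simplicial_complex_X: "abstract_simplicial_complex (X G)"
  unfolding abstract_simplicial_complex_def
proof (intro conjI ballI allI impI)
  fix s assume s: "s \<in> simplices (X G)"
  then show "s \<noteq> {}" "finite s"
    by (auto simp: simplices_X_iff X_face_def)
  show "s \<subseteq> verts (X G)"
  proof -
    have "(x, 1) \<in> verts (X G)" "(y, 1) \<in> verts (X G)" "(y, 2) \<in> verts (X G)"
      "(x \<otimes> y, 2) \<in> verts (X G)" if "(x, y) \<in> noncommuting G" for x y
      \<comment> \<open>The product is noncentral because \<open>x\<close> is a partner for
        it.\<close>
      using that noncommuting_sym[OF that] noncommuting_sym[OF noncommuting_mult(1)[OF that]]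
      by (auto simp only: verts_X_iff)
    then show ?thesis using s by (fastforce simp: simplices_X_iff X_face_def)
  qed
next
  fix v assume "v \<in> verts (X G)"
  then show "{v} \<in> simplices (X G)" by (auto simp: simplices_X_iff)
next
  fix s t assume s: "s \<in> simplices (X G)" and t: "t \<subseteq> s \<and> t \<noteq> {}"
  have vert: "{(x, i)} \<in> simplices (X G)"
    if "(x, y) \<in> noncommuting G" "i = 1 \<or> i = 2" for x y i
    using that by (auto simp: simplices_X_iff verts_X_iff)
  have edge: "{(x, 1), (y, 1)} \<in> simplices (X G)" "{(x, 1), (y, 2)} \<in> simplices (X G)"
    if "(x, y) \<in> noncommuting G" for x y
    using that by (auto simp: simplices_X_iff)
  \<comment> \<open>The two kinds of edges are treated together, with \<open>i\<close> the level of
    the second vertex.\<close>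
  from s consider v where "s = {v}"
    | x y i where "(x, y) \<in> noncommuting G" "s = {(x, 1), (y, i)}" "i = 1 \<or> i = 2"
    | x y where "(x, y) \<in> noncommuting G" "s = set (X_face G x y)"
    unfolding simplices_X_iff by blast
  then show "t \<in> simplices (X G)"
  proof cases
    case 1
    with s t show ?thesis by (auto simp: subset_singleton_iff)
  next
    case 2
    then have "t \<in> {{(x, 1)}, {(y, i)}, s}" using t by auto
    with 2 s show ?thesis
      using vert[OF 2(1)] vert[OF noncommuting_sym[OF 2(1)]] by auto
  next
    case 3
    let ?z = "x \<otimes> y"
    have "t \<in> {{(x, 1)}, {(y, 1)}, {(?z, 2)}, {(x, 1), (y, 1)}, {(x, 1), (?z, 2)},
        {(y, 1), (?z, 2)}, s}"
      using nonempty_subset_of_three[of t "(x, 1)" "(y, 1)" "(?z, 2)"] t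
      unfolding 3(2) by (simp add: X_face_def)
    \<comment> \<open>Each of the six proper faces is listed in \<open>X G\<close>: the edges at
      \<open>?z\<close> come from the pairs \<open>(x, ?z)\<close> and \<open>(y, ?z)\<close>, and
      \<open>?z\<close> itself is a vertex with partner \<open>x\<close>.\<close>
    moreover note s edge[OF 3(1)] edge[OF noncommuting_mult(1)[OF 3(1)]]
      edge[OF noncommuting_mult(2)[OF 3(1)]] vert[OF 3(1)] vert[OF noncommuting_sym[OF 3(1)]]
      vert[OF noncommuting_sym[OF noncommuting_mult(1)[OF 3(1)]]]
    ultimately show ?thesis by (elim insertE emptyE) simp_all
  qed
qed

lemma (in group) finite_oriented_2_complex_X:
  assumes "finite (carrier G)"
  shows "finite_oriented_2_complex (X G)"
  unfolding finite_oriented_2_complex_def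
proof (intro conjI ballI allI impI)
  show "abstract_simplicial_complex (X G)" by (rule abstract_simplicial_complex_X)
  show "finite (verts (X G))" using assms by (simp add: X_def)
  show "card s \<le> 3" if "s \<in> simplices (X G)" for s
    using that by (auto simp: simplices_X_iff X_face_def card_insert_if)
  show "verts (X G) = {} \<or> two_simplices (X G) \<noteq> {}"
  proof (cases "verts (X G) = {}")
    case False
    \<comment> \<open>A vertex and a partner of it span a face, so \<open>X G\<close> cannot have
      dimension 0 or 1.\<close>
    then obtain x i where "(x, i) \<in> verts (X G)" by auto
    then obtain y where "(x, y) \<in> noncommuting G" unfolding verts_X_iff by blast
    then have "set (X_face G x y) \<in> two_simplices (X G)" by (auto simp: two_simplices_X_iff)
    then show ?thesis by blast
  qed simp
  show "orient (X G) s \<in> orientations s" if s: "s \<in> two_simplices (X G)" for s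
  proof -
    obtain x y where xy: "(x, y) \<in> noncommuting G" "s = set (X_face G x y)"
      using s unfolding two_simplices_X_iff by blast
    then have "X_face G x y \<in> orderings s" by (simp add: orderings_def distinct_X_face)
    then show ?thesis
      unfolding xy(2) orient_X_face[OF xy(1)] orientations_def by (rule quotientI)
  qed
  show "orient (X G) s = {}" if "s \<notin> two_simplices (X G)" for s
    using that unfolding two_simplices_X_iff by (auto simp: X_def)
qed

section \<open>The simplicial map induced by a homomorphism\<close>

lemma hom_inj_comm_noncommuting:
  assumes "group G" "group H" and f: "f \<in> hom_inj_comm G H"
    and xy: "(x, y) \<in> noncommuting G"
  shows "(f x, f y) \<in> noncommuting H"
proof -
  interpret G: group G by fact
  interpret H: group H by fact
  interpret group_hom G H f
    using f by unfold_locales (simp add: hom_inj_comm_def)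
  have x: "x \<in> carrier G" and y: "y \<in> carrier G" and ne: "x \<otimes>\<^bsub>G\<^esub> y \<noteq> y \<otimes>\<^bsub>G\<^esub> x"
    using xy by (auto simp: noncommuting_iff)
  let ?c = "x \<otimes>\<^bsub>G\<^esub> y \<otimes>\<^bsub>G\<^esub> inv\<^bsub>G\<^esub> x \<otimes>\<^bsub>G\<^esub> inv\<^bsub>G\<^esub> y"
  have "?c \<in> derived G (carrier G)" "\<one>\<^bsub>G\<^esub> \<in> derived G (carrier G)"
    unfolding derived_def using x y by (auto intro!: generate.incl generate.one)
  moreover have "inj_on f (derived G (carrier G))" using f by (simp add: hom_inj_comm_def)
  moreover have "?c \<noteq> \<one>\<^bsub>G\<^esub>" using G.commutator_eq_one_iff[OF x y] ne by simp
  ultimately have "f ?c \<noteq> f \<one>\<^bsub>G\<^esub>" by (meson inj_onD)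
  \<comment> \<open>\<open>f ?c\<close> is the commutator of \<open>f x\<close> and
    \<open>f y\<close>, and \<open>f\<close> preserves the identity.\<close>
  then have "f x \<otimes>\<^bsub>H\<^esub> f y \<noteq> f y \<otimes>\<^bsub>H\<^esub> f x"
    using x y H.commutator_eq_one_iff[of "f x" "f y"] by simp
  with x y show ?thesis by (simp add: noncommuting_iff)
qed

lemma X_map_vert: "v \<in> verts (X G) \<Longrightarrow> X_map G f v = (f (fst v), snd v)"
  by (cases v) (simp add: X_map_def)

lemma X_map_face:
  assumes "group G" "f \<in> hom G H" and xy: "(x, y) \<in> noncommuting G"
  shows "map (X_map G f) (X_face G x y) = X_face H (f x) (f y)"
proof -
  have "x \<in> carrier G" "y \<in> carrier G" using xy by (auto simp: noncommuting_iff)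
  \<comment> \<open>\<open>X_map\<close> is \<open>undefined\<close> off the vertices, so it can be
    evaluated on the face only after all three entries are known to be vertices.\<close>
  moreover have "set (X_face G x y) \<subseteq> verts (X G)"
    using group.abstract_simplicial_complex_X[OF assms(1)] xy
    unfolding abstract_simplicial_complex_def by (meson simplices_X_iff)
  ultimately show ?thesis using assms(2)
    by (simp add: X_face_def X_map_vert hom_mult)
qed

text \<open>A partner \<open>y\<close> of \<open>x\<close> yields the partner \<open>f y\<close> of
  \<open>f x\<close>, so noncentral elements stay noncentral.\<close>

lemma X_map_in_verts:
  assumes "group G" "group H" "f \<in> hom_inj_comm G H" "v \<in> verts (X G)"
  shows "X_map G f v \<in> verts (X H)"
  using assms hom_inj_comm_noncommuting[OF assms(1-3)]
  by (cases v) (auto simp: X_map_vert verts_X_iff)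

text \<open>Edges and faces are indexed by non-commuting pairs, and \<open>f\<close> preserves such
  pairs. Hence no edge or face collapses, even when \<open>f\<close> has a kernel, and the ordered
  list of a face goes to the ordered list of its image, which carries the orientation class
  along.\<close>

lemma X_map_oriented_simplicial:
  assumes "group G" "group H" and f: "f \<in> hom_inj_comm G H"
  shows "X_map G f \<in> oriented_simplicial_maps (X G) (X H)"
proof -
  have hom: "f \<in> hom G H" using f by (simp add: hom_inj_comm_def)
  note nc = hom_inj_comm_noncommuting[OF assms]
  note face = X_map_face[OF assms(1) hom]
  have set_face: "X_map G f ` set (X_face G x y) = set (X_face H (f x) (f y))"
    if "(x, y) \<in> noncommuting G" for x y
    using face[OF that] by (metis set_map)
  have "X_map G f ` s \<in> simplices (X H)" if s: "s \<in> simplices (X G)" for s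
  proof -
    from s consider v where "v \<in> verts (X G)" "s = {v}"
      | x y i where "(x, y) \<in> noncommuting G" "s = {(x, 1), (y, i)}" "i = 1 \<or> i = 2"
      | x y where "(x, y) \<in> noncommuting G" "s = set (X_face G x y)"
      unfolding simplices_X_iff by blast
    then show ?thesis
    proof cases
      case 1
      then show ?thesis using X_map_in_verts[OF assms] by (auto simp: simplices_X_iff)
    next
      case 2
      then have "(x, 1) \<in> verts (X G)" "(y, i) \<in> verts (X G)"
        by (auto simp: verts_X_iff intro: noncommuting_sym)
      then have "X_map G f ` s = {(f x, 1), (f y, i)}"
        using 2 by (simp add: X_map_vert)
      then show ?thesis using nc[OF 2(1)] 2(3) by (auto simp: simplices_X_iff)
    next
      case 3
      then show ?thesis using nc[OF 3(1)] set_face[OF 3(1)] by (auto simp: simplices_X_iff)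
    qed
  qed
  moreover have "X_map G f ` s \<in> two_simplices (X H) \<and>
      map (X_map G f) ` orient (X G) s = orient (X H) (X_map G f ` s)"
    if s: "s \<in> two_simplices (X G)" for s
  proof -
    obtain x y where xy: "(x, y) \<in> noncommuting G" "s = set (X_face G x y)"
      using s unfolding two_simplices_X_iff by blast
    then show ?thesis
      using nc[OF xy(1)]
      by (auto simp only: set_face orient_X_face even_perm_rel_map face two_simplices_X_iff)
  qed
  ultimately show ?thesis
    using X_map_in_verts[OF assms]
    by (auto simp: oriented_simplicial_maps_def simplicial_map_def
        orientation_preserving_def X_map_def)
qed

section \<open>Composition, identities and the category of groups\<close>

lemma hom_inj_comm_compose:
  assumes "group G" "group H" "group K"
    and f: "f \<in> hom_inj_comm G H" and g: "g \<in> hom_inj_comm H K"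
  shows "compose (carrier G) g f \<in> hom_inj_comm G K"
proof -
  interpret G: group G by fact
  interpret group_hom G H f
    using assms by (simp add: group_hom_def group_hom_axioms_def hom_inj_comm_def)
  have sub: "derived G (carrier G) \<subseteq> carrier G"
    by (simp add: G.derived_in_carrier)
  \<comment> \<open>\<open>f\<close> maps the derived subgroup of \<open>G\<close> into that of
    \<open>H\<close>, which is where \<open>g\<close> is injective.\<close>
  have "f ` derived G (carrier G) = derived H (f ` carrier G)"
    by (simp add: derived_img)
  also have "\<dots> \<subseteq> derived H (carrier H)"
    by (rule H.mono_derived) auto
  finally have "inj_on (g \<circ> f) (derived G (carrier G))"
    using f g by (auto simp: hom_inj_comm_def intro: comp_inj_on inj_on_subset)
  then have "inj_on (compose (carrier G) g f) (derived G (carrier G))"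
    using sub by (auto simp: inj_on_def compose_def subset_iff)
  moreover have "compose (carrier G) g f \<in> hom G K"
    using f g by (auto simp: hom_inj_comm_def hom_def compose_def Pi_iff)
  ultimately show ?thesis by (simp add: hom_inj_comm_def)
qed

lemma X_map_compose:
  assumes "group G" "group H" "f \<in> hom_inj_comm G H"
  shows "X_map G (compose (carrier G) g f) = compose (verts (X G)) (X_map H g) (X_map G f)"
proof
  fix v
  show "X_map G (compose (carrier G) g f) v = compose (verts (X G)) (X_map H g) (X_map G f) v"
  proof (cases "v \<in> verts (X G)")
    case True
    \<comment> \<open>Both sides are now evaluated away from their default values:
      \<open>fst v\<close> lies in the carrier, and \<open>X_map G f v\<close> is again a
      vertex.\<close>
    then have "fst v \<in> carrier G" by (cases v) (auto simp: verts_X_iff noncommuting_iff)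
    with True X_map_in_verts[OF assms True] show ?thesis
      by (simp add: X_map_vert compose_def)
  qed (simp add: compose_def X_map_def)
qed

lemma X_map_ident: "X_map G (\<lambda>x\<in>carrier G. x) = (\<lambda>v\<in>verts (X G). v)"
  by (auto simp: X_map_def verts_X_iff noncommuting_iff intro!: restrict_ext)

lemma ident_in_hom_inj_comm:
  assumes "group G"
  shows "(\<lambda>x\<in>carrier G. x) \<in> hom_inj_comm G G"
proof -
  interpret group G by fact
  show ?thesis
    using derived_in_carrier[of "carrier G"]
    by (auto simp: hom_inj_comm_def hom_def inj_on_def subset_iff)
qed

lemma category_group_cat: "category (group_cat :: ('u monoid, 'u \<Rightarrow> 'u) category)"
proof
  fix A B D E :: "'u monoid" and f g h
  show "A \<in> Obj group_cat \<Longrightarrow> Ident group_cat A \<in> Hom group_cat A A"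
    by (simp add: group_cat_def ident_in_hom_inj_comm)
  show "\<lbrakk>A \<in> Obj group_cat; B \<in> Obj group_cat; D \<in> Obj group_cat; f \<in> Hom group_cat A B;
      g \<in> Hom group_cat B D\<rbrakk> \<Longrightarrow> Comp group_cat A B D g f \<in> Hom group_cat A D"
    by (auto simp: group_cat_def intro: hom_inj_comm_compose)
  \<comment> \<open>The identity laws are equalities of functions because morphisms are extensional
    on the carrier.\<close>
  show "\<lbrakk>A \<in> Obj group_cat; B \<in> Obj group_cat; f \<in> Hom group_cat A B\<rbrakk>
      \<Longrightarrow> Comp group_cat A A B f (Ident group_cat A) = f"
    by (auto simp: group_cat_def hom_inj_comm_def hom_def intro: compose_Id)
  show "\<lbrakk>A \<in> Obj group_cat; B \<in> Obj group_cat; f \<in> Hom group_cat A B\<rbrakk>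
      \<Longrightarrow> Comp group_cat A B B (Ident group_cat B) f = f"
    by (auto simp: group_cat_def hom_inj_comm_def hom_def intro: Id_compose)
  show "\<lbrakk>A \<in> Obj group_cat; B \<in> Obj group_cat; D \<in> Obj group_cat; E \<in> Obj group_cat;
      f \<in> Hom group_cat A B; g \<in> Hom group_cat B D; h \<in> Hom group_cat D E\<rbrakk>
    \<Longrightarrow> Comp group_cat A D E h (Comp group_cat A B D g f)
        = Comp group_cat A B E (Comp group_cat B D E h g) f"
    by (auto simp: group_cat_def hom_inj_comm_def hom_def intro: compose_assoc)
qed

section \<open>The category of oriented complexes\<close>

lemma compose_image: "s \<subseteq> A \<Longrightarrow> compose A g f ` s = g ` f ` s"
  by (force simp: compose_def image_iff)

text \<open>Permuting positions keeps the set of entries, so each list in an orientation class of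
  \<open>s\<close> has its entries in \<open>s\<close>. Maps restricted to \<open>verts K\<close>
  can therefore be evaluated along such lists.\<close>

lemma set_orient_subset_verts:
  assumes "finite_oriented_2_complex K" "s \<in> two_simplices K" "vs \<in> orient K s"
  shows "set vs \<subseteq> verts K"
proof -
  have "orient K s \<in> orientations s" "s \<subseteq> verts K"
    using assms by (auto simp: finite_oriented_2_complex_def abstract_simplicial_complex_def
        two_simplices_def)
  then show ?thesis
    using assms(3)
    by (fastforce simp: orientations_def quotient_def orderings_def even_perm_rel_def)
qed

text \<open>The restriction built into \<open>compose\<close> is invisible on simplices and on the
  orderings in \<open>orient K s\<close>, since both stay inside \<open>verts K\<close>.\<close>

lemma oriented_simplicial_maps_compose:
  assumes K: "finite_oriented_2_complex K"
    and f: "f \<in> oriented_simplicial_maps K L" and g: "g \<in> oriented_simplicial_maps L M"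
  shows "compose (verts K) g f \<in> oriented_simplicial_maps K M"
proof -
  have sub: "s \<subseteq> verts K" if "s \<in> simplices K" for s
    using K that by (auto simp: finite_oriented_2_complex_def abstract_simplicial_complex_def)
  have "map (compose (verts K) g f) ` orient K s = map g ` map f ` orient K s"
    if "s \<in> two_simplices K" for s
  proof -
    have "map (compose (verts K) g f) vs = map g (map f vs)" if "vs \<in> orient K s" for vs
      using set_orient_subset_verts[OF K \<open>s \<in> two_simplices K\<close> that]
      by (auto simp: compose_def)
    then show ?thesis unfolding image_image by (intro image_cong) simp_all
  qed
  moreover have "s \<in> simplices K" if "s \<in> two_simplices K" for s
    using that by (simp add: two_simplices_def)
  ultimately show ?thesis
    using f g sub
    by (auto simp: oriented_simplicial_maps_def simplicial_map_def orientation_preserving_def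
        compose_image compose_eq Pi_iff)
qed

lemma ident_in_oriented_simplicial_maps:
  assumes K: "finite_oriented_2_complex K"
  shows "(\<lambda>v\<in>verts K. v) \<in> oriented_simplicial_maps K K"
proof -
  have im: "(\<lambda>v\<in>verts K. v) ` s = s" if "s \<in> simplices K" for s
  proof -
    have "s \<subseteq> verts K"
      using K that by (auto simp: finite_oriented_2_complex_def abstract_simplicial_complex_def)
    then have "(\<lambda>v\<in>verts K. v) ` s = (\<lambda>v. v) ` s" by (intro image_cong) auto
    then show ?thesis by simp
  qed
  have "map (\<lambda>v\<in>verts K. v) ` orient K s = orient K s" if "s \<in> two_simplices K" for s
  proof -
    have "map (\<lambda>v\<in>verts K. v) vs = vs" if "vs \<in> orient K s" for vs
      using set_orient_subset_verts[OF K \<open>s \<in> two_simplices K\<close> that] by (intro map_idI) auto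
    then have "map (\<lambda>v\<in>verts K. v) ` orient K s = (\<lambda>vs. vs) ` orient K s"
      by (intro image_cong) simp_all
    then show ?thesis by simp
  qed
  then show ?thesis
    using im by (auto simp: oriented_simplicial_maps_def simplicial_map_def
        orientation_preserving_def two_simplices_def)
qed

lemma category_complex_cat:
  "category (complex_cat :: ('v oriented_complex, 'v \<Rightarrow> 'v) category)"
proof
  let ?C = "complex_cat :: ('v oriented_complex, 'v \<Rightarrow> 'v) category"
  fix A B D E :: "'v oriented_complex" and f g h
  show "A \<in> Obj ?C \<Longrightarrow> Ident ?C A \<in> Hom ?C A A"
    by (simp add: complex_cat_def ident_in_oriented_simplicial_maps)
  show "\<lbrakk>A \<in> Obj ?C; B \<in> Obj ?C; D \<in> Obj ?C; f \<in> Hom ?C A B; g \<in> Hom ?C B D\<rbrakk>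
      \<Longrightarrow> Comp ?C A B D g f \<in> Hom ?C A D"
    by (auto simp: complex_cat_def intro: oriented_simplicial_maps_compose)
  show "\<lbrakk>A \<in> Obj ?C; B \<in> Obj ?C; f \<in> Hom ?C A B\<rbrakk> \<Longrightarrow> Comp ?C A A B f (Ident ?C A) = f"
    by (auto simp: complex_cat_def oriented_simplicial_maps_def simplicial_map_def
        intro: compose_Id)
  show "\<lbrakk>A \<in> Obj ?C; B \<in> Obj ?C; f \<in> Hom ?C A B\<rbrakk> \<Longrightarrow> Comp ?C A B B (Ident ?C B) f = f"
    by (auto simp: complex_cat_def oriented_simplicial_maps_def simplicial_map_def
        intro: Id_compose)
  show "\<lbrakk>A \<in> Obj ?C; B \<in> Obj ?C; D \<in> Obj ?C; E \<in> Obj ?C;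
      f \<in> Hom ?C A B; g \<in> Hom ?C B D; h \<in> Hom ?C D E\<rbrakk>
    \<Longrightarrow> Comp ?C A D E h (Comp ?C A B D g f) = Comp ?C A B E (Comp ?C B D E h g) f"
    by (auto simp: complex_cat_def oriented_simplicial_maps_def simplicial_map_def
        intro: compose_assoc)
qed

section \<open>The functor, isomorphic groups and subgroups\<close>

lemma covariant_functor_X:
  "covariant_functor (group_cat :: ('u monoid, 'u \<Rightarrow> 'u) category) complex_cat
     X (\<lambda>G H f. X_map G f)"
proof (intro covariant_functor.intro covariant_functor_axioms.intro
    category_group_cat category_complex_cat)
qed (auto simp: group_cat_def complex_cat_def group.finite_oriented_2_complex_X
    X_map_ident X_map_compose intro: X_map_oriented_simplicial)

text \<open>Injectivity on the whole carrier covers the derived subgroup; restricting provides the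
  extensionality required of morphisms.\<close>

lemma iso_in_hom_inj_comm:
  fixes G :: "'a monoid" and H :: "'b monoid"
  assumes "group G" "h \<in> iso G H"
  shows "restrict h (carrier G) \<in> hom_inj_comm G H"
proof -
  interpret group G by fact
  have "derived G (carrier G) \<subseteq> carrier G" by (simp add: derived_in_carrier)
  moreover have "inj_on h (carrier G)" using assms(2) by (simp add: iso_def bij_betw_def)
  ultimately have "inj_on (restrict h (carrier G)) (derived G (carrier G))"
    by (auto simp: inj_on_def subset_iff)
  moreover have "restrict h (carrier G) \<in> hom G H"
    using assms(2) by (auto simp: iso_def hom_def)
  ultimately show ?thesis by (simp add: hom_inj_comm_def)
qed

text \<open>Serves to replace the \<open>inv_into\<close> in \<open>simplicial_iso\<close> by an
  induced map that agrees with it only on vertices.\<close>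

lemma simplicial_map_cong:
  assumes "abstract_simplicial_complex K" "\<And>v. v \<in> verts K \<Longrightarrow> \<phi> v = \<psi> v"
  shows "simplicial_map \<phi> K L \<longleftrightarrow> simplicial_map \<psi> K L"
proof -
  have "\<phi> ` s = \<psi> ` s" if "s \<in> simplices K" for s
    using assms that by (intro image_cong) (auto simp: abstract_simplicial_complex_def)
  moreover have "\<phi> \<in> verts K \<rightarrow> verts L \<longleftrightarrow> \<psi> \<in> verts K \<rightarrow> verts L"
    using assms(2) by (auto simp: Pi_iff)
  ultimately show ?thesis by (simp add: simplicial_map_def)
qed

text \<open>Functors preserve isomorphisms. As \<open>G\<close> and \<open>H\<close> may have
  different element types, the argument is carried out on \<open>X_map\<close> directly: the maps
  induced by an isomorphism and its inverse are mutually inverse.\<close>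

lemma X_iso:
  fixes G :: "'a monoid" and H :: "'b monoid"
  assumes G: "group G" and H: "group H" and "G \<cong> H"
  shows "\<exists>\<phi>. simplicial_iso \<phi> (X G) (X H) \<and> orientation_preserving \<phi> (X G) (X H)"
proof -
  obtain h where h: "h \<in> iso G H" using assms(3) by (auto simp: is_iso_def)
  define f where "f = restrict h (carrier G)"
  define g where "g = restrict (inv_into (carrier G) h) (carrier H)"
  have f: "f \<in> hom_inj_comm G H" unfolding f_def by (rule iso_in_hom_inj_comm[OF G h])
  have g: "g \<in> hom_inj_comm H G"
    unfolding g_def by (rule iso_in_hom_inj_comm[OF H group.iso_set_sym[OF G h]])
  have bij: "bij_betw h (carrier G) (carrier H)" using h by (simp add: iso_def)
  have "compose (carrier G) g f = (\<lambda>x\<in>carrier G. x)"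
    using bij by (auto simp: compose_def f_def g_def fun_eq_iff bij_betw_inv_into_left
        bij_betwE)
  then have gf: "compose (verts (X G)) (X_map H g) (X_map G f) = (\<lambda>v\<in>verts (X G). v)"
    by (metis X_map_compose[OF G H f] X_map_ident)
  have "compose (carrier H) f g = (\<lambda>x\<in>carrier H. x)"
    using bij bij_betw_inv_into[OF bij]
    by (auto simp: compose_def f_def g_def fun_eq_iff bij_betw_inv_into_right bij_betwE)
  then have fg: "compose (verts (X H)) (X_map G f) (X_map H g) = (\<lambda>v\<in>verts (X H). v)"
    by (metis X_map_compose[OF H G g] X_map_ident)
  have gf': "X_map H g (X_map G f v) = v" if "v \<in> verts (X G)" for v
    using fun_cong[OF gf, of v] that by (simp add: compose_def)
  have fg': "X_map G f (X_map H g v) = v" if "v \<in> verts (X H)" for v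
    using fun_cong[OF fg, of v] that by (simp add: compose_def)
  have bijX: "bij_betw (X_map G f) (verts (X G)) (verts (X H))"
    using gf' fg' X_map_in_verts[OF G H f] X_map_in_verts[OF H G g]
    by (intro bij_betw_byWitness[where f' = "X_map H g"]) auto
  \<comment> \<open>By bijectivity the preimage chosen by \<open>inv_into\<close> is the one given
    by \<open>X_map H g\<close>.\<close>
  have inv: "inv_into (verts (X G)) (X_map G f) v = X_map H g v" if "v \<in> verts (X H)" for v
    using bijX fg'[OF that] X_map_in_verts[OF H G g that]
    by (metis bij_betw_inv_into_left)
  have "simplicial_map (X_map G f) (X G) (X H)" "orientation_preserving (X_map G f) (X G) (X H)"
    "simplicial_map (X_map H g) (X H) (X G)"
    using X_map_oriented_simplicial[OF G H f] X_map_oriented_simplicial[OF H G g]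
    by (auto simp: oriented_simplicial_maps_def)
  moreover have "simplicial_map (inv_into (verts (X G)) (X_map G f)) (X H) (X G)"
    using simplicial_map_cong[OF group.abstract_simplicial_complex_X[OF H]] inv calculation
    by metis
  ultimately show ?thesis
    using bijX unfolding simplicial_iso_def by blast
qed

text \<open>Elements of \<open>H\<close> that do not commute in \<open>H\<close> do not commute in
  \<open>G\<close>, so noncentral elements of \<open>H\<close> are noncentral in \<open>G\<close>.
  The product is inherited, hence the faces are the same lists and have the same orientation
  classes.\<close>

lemma subcomplex_X_subgroup:
  assumes "group G" "subgroup H G"
  shows "subcomplex (X (G\<lparr>carrier := H\<rparr>)) (X G)"
proof -
  let ?H = "G\<lparr>carrier := H\<rparr>"
  have nc: "(x, y) \<in> noncommuting G" if "(x, y) \<in> noncommuting ?H" for x y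
    using that subgroup.subset[OF assms(2)] by (auto simp: noncommuting_iff)
  have face: "X_face ?H x y = X_face G x y" for x y
    by (simp add: X_face_def)
  have "verts (X ?H) \<subseteq> verts (X G)"
    using nc by (auto simp: verts_X_iff) blast+
  moreover from this have "simplices (X ?H) \<subseteq> simplices (X G)"
    using nc unfolding subset_iff simplices_X_iff face by blast
  moreover have "orient (X ?H) s = orient (X G) s" if "s \<in> two_simplices (X ?H)" for s
    using that nc orient_X_face[of _ _ ?H] orient_X_face[of _ _ G]
    by (auto simp: two_simplices_X_iff face)
  ultimately show ?thesis
    using group.abstract_simplicial_complex_X[OF group.subgroup_imp_group[OF assms]]
    by (simp add: subcomplex_def)
qed

text \<open>The functor clause concerns groups over one common element type; the second conjunct
  gives the action on morphisms and composites across three possibly different types.\<close>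

theorem proposition2p24:
  fixes G1 :: "'a monoid" and G2 :: "'b monoid" and G3 :: "'c monoid"
  shows "covariant_functor
           (group_cat :: ('u monoid, 'u \<Rightarrow> 'u) category)
           (complex_cat :: (('u \<times> nat) oriented_complex, 'u \<times> nat \<Rightarrow> 'u \<times> nat) category)
           X (\<lambda>G H f. X_map G f)
       \<and> (\<forall>f g. group G1 \<and> finite (carrier G1) \<and> group G2 \<and> finite (carrier G2) \<and>
            group G3 \<and> finite (carrier G3) \<and> f \<in> hom_inj_comm G1 G2 \<and> g \<in> hom_inj_comm G2 G3 \<longrightarrow>
            X_map G1 f \<in> oriented_simplicial_maps (X G1) (X G2) \<and>
            compose (carrier G1) g f \<in> hom_inj_comm G1 G3 \<and>
            X_map G1 (compose (carrier G1) g f)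
              = compose (verts (X G1)) (X_map G2 g) (X_map G1 f))
       \<and> (group G1 \<and> finite (carrier G1) \<and> group G2 \<and> finite (carrier G2) \<and> G1 \<cong> G2 \<longrightarrow>
            (\<exists>\<phi>. simplicial_iso \<phi> (X G1) (X G2) \<and> orientation_preserving \<phi> (X G1) (X G2)))
       \<and> (\<forall>H. group G1 \<and> finite (carrier G1) \<and> subgroup H G1 \<longrightarrow>
            subcomplex (X (G1\<lparr>carrier := H\<rparr>)) (X G1))"
  by (intro conjI allI impI covariant_functor_X; elim conjE)
    (simp_all add: X_map_oriented_simplicial hom_inj_comm_compose[of G1 G2 G3] X_map_compose
      X_iso subcomplex_X_subgroup)

end
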